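(* Consider a parallel server network of class (D) (dominant server pool) or class (C) (class-dependent service rates), as described in the context, and suppose that $\varrho>0$. Let $u=(u^c,u^s):\mathbb R^m\to\varDelta$ be a stationary Markov control and let $\pi_u$ denote the invariant probability measure of the limiting diffusion under $u$ (which exists since $\varrho>0$). Then $$\varrho=\int_{\mathbb R^m}\Bigl(1+\bigl\langle e,B_1^{-1}B_2u^s(x)\bigr\rangle\Bigr)\langle e,x\rangle^-\,\pi_u(dx).$$
   Context: **Network.** $\mathcal I=\{1,\dots,m\}$ is the set of customer classes, $\mathcal J=\{1,\dots,J\}$ the set of server pools, $\mathcal J(i)\subset\mathcal J$ the set of pools that can serve class $i$, $\mathcal I(j)$ the set of classes pool $j$ can serve. The bipartite graph on $\mathcal I\cup\mathcal J$ with edges $(i,j)$, $j\in\mathcal J(i)$ (written $i\sim j$) is a tree. The parameters are: $\lambda_i,\nu_j>0$, $\mu_{ij}>0$ for $i\sim j$ ($\mu_{ij}=0$ otherwise), and real constants $\hat\lambda_i,\hat\mu_{ij},\hat\nu_j$ (the limits, in the Halfin--Whitt regime without abandonment, of $\lambda^n_i/n$, $N^n_j/n$, $\mu^n_{ij}$, $(\lambda_i^n-n\lambda_i)/\sqrt n$, $\sqrt n(\mu_{ij}^n-\mu_{ij})$, $(N_j^n-n\nu_j)/\sqrt n$, where $\lambda_i^n,\mu_{ij}^n,N_j^n$ are arrival rates, service rates and numbers of servers of the $n$-th system). **Complete resource pooling.** The linear program: minimize $\max_j\sum_{i\in\mathcal I(j)}\xi_{ij}$ over nonnegative $\xi$ with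 $\xi_{ij}=0$ for $i\nsim j$, subject to $\sum_{j\in\mathcal J(i)}\mu_{ij}\nu_j\xi_{ij}=\lambda_i$ for all $i$, has a unique solution $\xi^*$, and $\sum_i\xi^*_{ij}=1$ for all $j$, $\xi^*_{ij}>0$ for $i\sim j$. **The two classes.** (D): the tree has exactly one non-leaf server node, labelled $j=1$ (so $1\in\mathcal J(i)$ for all $i$); $\mathcal J_1(i)=\mathcal J(i)\setminus\{1\}$; $B_1=\mathrm{diag}(\mu_{11},\dots,\mu_{m1})$ and $(B_2)_{ij}=\mu_{ij}-\mu_{i1}$ if $j\in\mathcal J_1(i)$, $0$ otherwise ($B_2\in\mathbb R^{m\times J}$). (C): arbitrary tree with $\mu_{ij}=\mu_i$ for all $i\sim j$; $B_1=\mathrm{diag}(\mu_1,\dots,\mu_m)$, $B_2=0$. **Diffusion limit.** $\ell_i=\hat\lambda_i-\sum_{j\in\mathcal J(i)}\hat\mu_{ij}\xi^*_{ij}\nu_j-\sum_{j\in\mathcal J(i)}\mu_{ij}\xi^*_{ij}\hat\nu_j$; $e=(1,\dots,1)$; spare capacity $\varrho=-\langle e,B_1^{-1}\ell\rangle$. $\varDelta=\varDelta_c\times\varDelta_s$ with $\varDelta_c\subset\mathbb R^m$, $\varDelta_s\subset\mathbb R^J$ the probability simplices. $b(x,u)=\ell-B_1(x-\langle e,x\rangle^+u^c)+B_2u^s\langle e,x\rangle^-$, $t^\pm=\max\{\pm t,0\}$. A stationary Markov control is a Borel map $u:\mathbb R^m\to\varDelta$, and the diffusion under it is $dX_t=b(X_t,u(X_t))dt+\mathrm{diag}(\sqrt{2\lambda_1},\dots,\sqrt{2\lambda_m})\,dW_t$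 with $W$ a standard $m$-dimensional Brownian motion. *)

theory Defs
  imports "HOL-Probability.Probability"
begin

text \<open>Classes and pools are indexed by finite types \<open>'m\<close> and \<open>'j\<close>; \<open>E i j\<close> means that pool \<open>j\<close> can
  serve class \<open>i\<close>. So \<open>{j. E i j}\<close> is \<open>J(i)\<close> and \<open>{i. E i j}\<close> is \<open>I(j)\<close>.\<close>

fun adj :: "('m \<Rightarrow> 'j \<Rightarrow> bool) \<Rightarrow> 'm + 'j \<Rightarrow> 'm + 'j \<Rightarrow> bool" where
  "adj E (Inl i) (Inr j) = E i j"
| "adj E (Inr j) (Inl i) = E i j"
| "adj E _ _ = False"

text \<open>Undirected tree: connected and without cycles. A cycle has at least three distinct
  vertices, so that going back and forth along an edge does not count as one.\<close>

definition tree_network :: "('m \<Rightarrow> 'j \<Rightarrow> bool) \<Rightarrow> bool" where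
  "tree_network E \<longleftrightarrow>
     (\<forall>v w. (adj E)\<^sup>*\<^sup>* v w) \<and>
     \<not> (\<exists>p. 3 \<le> length p \<and> distinct p \<and> successively (adj E) p \<and> adj E (last p) (hd p))"

definition leaf_pool :: "('m \<Rightarrow> 'j \<Rightarrow> bool) \<Rightarrow> 'j \<Rightarrow> bool" where
  "leaf_pool E j \<longleftrightarrow> card {i. E i j} = 1"

definition lp_feasible ::
  "('m \<Rightarrow> 'j \<Rightarrow> bool) \<Rightarrow> real^'m \<Rightarrow> real^'j^'m \<Rightarrow> real^'j \<Rightarrow> real^'j^'m \<Rightarrow> bool" where
  "lp_feasible E lam mu nu \<xi> \<longleftrightarrow>
     (\<forall>i j. 0 \<le> \<xi> $ i $ j) \<and> (\<forall>i j. \<not> E i j \<longrightarrow> \<xi> $ i $ j = 0) \<and>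
     (\<forall>i. (\<Sum>j | E i j. mu $ i $ j * nu $ j * \<xi> $ i $ j) = lam $ i)"

definition lp_value :: "('m \<Rightarrow> 'j \<Rightarrow> bool) \<Rightarrow> real^'j^'m \<Rightarrow> real" where
  "lp_value E \<xi> = Max (range (\<lambda>j. \<Sum>i | E i j. \<xi> $ i $ j))"

definition complete_resource_pooling ::
  "('m \<Rightarrow> 'j \<Rightarrow> bool) \<Rightarrow> real^'m \<Rightarrow> real^'j^'m \<Rightarrow> real^'j \<Rightarrow> real^'j^'m \<Rightarrow> bool" where
  "complete_resource_pooling E lam mu nu \<xi>s \<longleftrightarrow>
     (\<forall>\<xi>. is_arg_min (lp_value E) (lp_feasible E lam mu nu) \<xi> \<longleftrightarrow> \<xi> = \<xi>s) \<and>
     (\<forall>j. (\<Sum>i\<in>UNIV. \<xi>s $ i $ j) = 1) \<and> (\<forall>i j. E i j \<longrightarrow> 0 < \<xi>s $ i $ j)"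

definition diag :: "real^'n \<Rightarrow> real^'n^'n" where
  "diag v = (\<chi> i k. if i = k then v $ i else 0)"

text \<open>Dominant server pool \<open>d\<close> (labelled 1 in the mathematical notation).\<close>

definition class_D ::
  "('m \<Rightarrow> 'j \<Rightarrow> bool) \<Rightarrow> real^'j^'m \<Rightarrow> 'j \<Rightarrow> real^'m^'m \<Rightarrow> real^'j^'m \<Rightarrow> bool" where
  "class_D E mu d B1 B2 \<longleftrightarrow>
     (\<forall>j. \<not> leaf_pool E j \<longleftrightarrow> j = d) \<and>
     B1 = diag (\<chi> i. mu $ i $ d) \<and>
     B2 = (\<chi> i j. if E i j \<and> j \<noteq> d then mu $ i $ j - mu $ i $ d else 0)"

text \<open>Class-dependent service rates: \<open>c $ i\<close> is the common rate of class \<open>i\<close>.\<close>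

definition class_C ::
  "('m \<Rightarrow> 'j \<Rightarrow> bool) \<Rightarrow> real^'j^'m \<Rightarrow> real^'m \<Rightarrow> real^'m^'m \<Rightarrow> real^'j^'m \<Rightarrow> bool" where
  "class_C E mu c B1 B2 \<longleftrightarrow>
     (\<forall>i j. E i j \<longrightarrow> mu $ i $ j = c $ i) \<and> B1 = diag c \<and> B2 = 0"

definition ell ::
  "('m \<Rightarrow> 'j \<Rightarrow> bool) \<Rightarrow> real^'j^'m \<Rightarrow> real^'j \<Rightarrow> real^'j^'m \<Rightarrow>
   real^'m \<Rightarrow> real^'j^'m \<Rightarrow> real^'j \<Rightarrow> real^'m" where
  "ell E mu nu \<xi>s lam_hat mu_hat nu_hat =
     (\<chi> i. lam_hat $ i - (\<Sum>j | E i j. mu_hat $ i $ j * \<xi>s $ i $ j * nu $ j)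
                       - (\<Sum>j | E i j. mu $ i $ j * \<xi>s $ i $ j * nu_hat $ j))"

text \<open>Here and below the numeral \<open>1 :: real^'m\<close> is the vector \<open>e = (1, \<dots>, 1)\<close>.\<close>

definition spare_capacity :: "real^'m^'m \<Rightarrow> real^'m \<Rightarrow> real" where
  "spare_capacity B1 l = - ((1 :: real^'m) \<bullet> (matrix_inv B1 *v l))"

definition prob_simplex :: "(real^'n) set" where
  "prob_simplex = {v. (\<forall>i. 0 \<le> v $ i) \<and> (\<Sum>i\<in>UNIV. v $ i) = 1}"

definition stationary_markov_control :: "(real^'m \<Rightarrow> (real^'m) \<times> (real^'j)) \<Rightarrow> bool" where
  "stationary_markov_control u \<longleftrightarrow>
     u \<in> borel_measurable borel \<and> (\<forall>x. u x \<in> prob_simplex \<times> prob_simplex)"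

definition pos_part :: "real \<Rightarrow> real" where "pos_part t = max t 0"
definition neg_part :: "real \<Rightarrow> real" where "neg_part t = max (- t) 0"

definition drift ::
  "real^'m \<Rightarrow> real^'m^'m \<Rightarrow> real^'j^'m \<Rightarrow> real^'m \<Rightarrow> (real^'m) \<times> (real^'j) \<Rightarrow> real^'m" where
  "drift l B1 B2 x v =
     l - B1 *v (x - pos_part (1 \<bullet> x) *\<^sub>R fst v) + neg_part (1 \<bullet> x) *\<^sub>R (B2 *v snd v)"

text \<open>Standard Brownian motion relative to a filtration. The time index is \<open>real\<close>, but only times
  \<open>t \<ge> 0\<close> matter (a filtration on \<open>[0, \<infinity>)\<close> extends by \<open>F t = F 0\<close> for \<open>t < 0\<close>). The law
  \<open>N(0, (t - s) I)\<close> of an increment is expressed through independent Gaussian components.\<close>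

definition brownian_motion ::
  "'w measure \<Rightarrow> (real \<Rightarrow> 'w measure) \<Rightarrow> (real \<Rightarrow> 'w \<Rightarrow> real^'m) \<Rightarrow> bool" where
  "brownian_motion M F W \<longleftrightarrow>
     prob_space M \<and> filtration (space M) F \<and> (\<forall>t\<ge>0. subalgebra M (F t)) \<and>
     (\<forall>t\<ge>0. W t \<in> borel_measurable (F t)) \<and>
     (AE \<omega> in M. W 0 \<omega> = 0 \<and> continuous_on {0..} (\<lambda>t. W t \<omega>)) \<and>
     (\<forall>s t. 0 \<le> s \<and> s < t \<longrightarrow>
        prob_space.indep_set M (sets (F s))
          {(\<lambda>\<omega>. W t \<omega> - W s \<omega>) -` A \<inter> space M | A. A \<in> sets borel} \<and>
        prob_space.indep_vars M (\<lambda>_. borel) (\<lambda>i \<omega>. (W t \<omega> - W s \<omega>) $ i) UNIV \<and>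
        (\<forall>i. distributed M lborel (\<lambda>\<omega>. (W t \<omega> - W s \<omega>) $ i) (normal_density 0 (sqrt (t - s)))))"

text \<open>Solution of \<open>dX = f(X) dt + \<sigma> dW\<close>, \<open>X(0) = x\<close>. As \<open>\<sigma>\<close> is constant, the stochastic integral
  is just \<open>\<sigma> W\<close>.\<close>

definition sde_solution ::
  "(real^'m \<Rightarrow> real^'m) \<Rightarrow> real^'m^'m \<Rightarrow> real^'m \<Rightarrow> 'w measure \<Rightarrow> (real \<Rightarrow> 'w measure) \<Rightarrow>
   (real \<Rightarrow> 'w \<Rightarrow> real^'m) \<Rightarrow> (real \<Rightarrow> 'w \<Rightarrow> real^'m) \<Rightarrow> bool" where
  "sde_solution f \<sigma> x M F W X \<longleftrightarrow>
     brownian_motion M F W \<and>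
     (\<forall>t\<ge>0. X t \<in> borel_measurable (F t)) \<and>
     (AE \<omega> in M. continuous_on {0..} (\<lambda>t. X t \<omega>) \<and>
        (\<forall>t\<ge>0. set_integrable lborel {0..t} (\<lambda>s. f (X s \<omega>)) \<and>
               X t \<omega> = x + (LINT s:{0..t}|lborel. f (X s \<omega>)) + \<sigma> *v W t \<omega>))"

text \<open>Invariance \<open>\<pi> P\<^sub>t = \<pi>\<close> of a probability measure under a family \<open>P t x\<close> of Markov transition
  kernels; \<open>\<pi> \<bind> P t\<close> is the measure \<open>A \<mapsto> \<integral> P t x A \<pi>(dx)\<close>.\<close>

definition invariant_prob_measure ::
  "(real \<Rightarrow> real^'m \<Rightarrow> (real^'m) measure) \<Rightarrow> (real^'m) measure \<Rightarrow> bool" where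
  "invariant_prob_measure P \<pi> \<longleftrightarrow>
     \<pi> \<in> space (prob_algebra borel) \<and>
     (\<forall>t\<ge>0. P t \<in> borel \<rightarrow>\<^sub>M prob_algebra borel \<and> \<pi> \<bind> P t = \<pi>)"

end

theory Submission
  imports Defs
begin

text \<open>With \<open>a = B\<^sub>1\<^sup>-\<^sup>1 e\<close>, the process \<open>Y = \<langle>a, X\<rangle>\<close> has drift \<open>h(X) - \<rho>\<close>, where \<open>h\<close> is the
  integrand of the claim, and \<open>h \<ge> 0\<close>. In stationarity \<open>Y\<^sub>1\<close> and \<open>Y\<^sub>0\<close> have the same law, and
  the negative part of \<open>Y\<^sub>1 - Y\<^sub>0\<close> is integrable since this difference is at least \<open>-\<rho>\<close> plus a
  centered Gaussian variable; hence \<open>E(Y\<^sub>1 - Y\<^sub>0) = 0\<close> although \<open>Y\<^sub>0\<close> itself need not be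
  integrable. Tonelli's theorem turns this into \<open>\<integral>h d\<pi> = \<rho>\<close>.\<close>

section \<open>Positive parts of differences, by truncation\<close>

lemma clamp_diff_eq:
  fixes a b :: real
  assumes "\<bar>a\<bar> \<le> k" "\<bar>b\<bar> \<le> k"
  shows "max (- k) (min k a) - max (- k) (min k b) = a - b"
  using assms by linarith

text \<open>Each side is the length of the part of \<open>[b, a]\<close> that lies in the truncation
  interval, and the wider interval keeps more of it.\<close>

lemma clamp_diff_mono:
  fixes a b :: real
  assumes "b \<le> a" "0 \<le> k" "k \<le> k'"
  shows "max (- k) (min k a) - max (- k) (min k b) \<le> max (- k') (min k' a) - max (- k') (min k' b)"
  using assms unfolding max_def min_def by (auto split: if_splits)

text \<open>\<open>ennreal\<close> sends negative reals to 0, so both sides are positive parts.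
  Clamping is monotone and 1-Lipschitz, hence never enlarges the positive part, and it does nothing
  once \<open>n\<close> exceeds both absolute values.\<close>

lemma SUP_clamp_diff:
  fixes a b :: real
  shows "(SUP n. ennreal (max (- real n) (min (real n) a) - max (- real n) (min (real n) b)))
    = ennreal (a - b)"
proof (rule antisym)
  obtain k :: nat where "max \<bar>a\<bar> \<bar>b\<bar> \<le> real k"
    using real_arch_simple by blast
  then show "ennreal (a - b) \<le> (SUP n. ennreal (max (- real n) (min (real n) a) - max (- real n) (min (real n) b)))"
    by (intro SUP_upper2[of k]) (auto simp: clamp_diff_eq)
next
  show "(SUP n. ennreal (max (- real n) (min (real n) a) - max (- real n) (min (real n) b))) \<le> ennreal (a - b)"
  proof (rule SUP_least)
    fix n :: nat
    show "ennreal (max (- real n) (min (real n) a) - max (- real n) (min (real n) b)) \<le> ennreal (a - b)"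
    proof (cases "a \<le> b")
      case True
      then have "max (- real n) (min (real n) a) - max (- real n) (min (real n) b) \<le> 0" by linarith
      then show ?thesis by (simp add: ennreal_neg)
    qed (intro ennreal_leI, linarith)
  qed
qed

lemma nn_integral_clamp_diff:
  fixes U V :: "'a \<Rightarrow> real"
  assumes [measurable]: "U \<in> borel_measurable M" "V \<in> borel_measurable M"
  shows "(\<integral>\<^sup>+w. ennreal (U w - V w) \<partial>M) =
    (SUP n. \<integral>\<^sup>+w. ennreal (max (- real n) (min (real n) (U w)) - max (- real n) (min (real n) (V w))) \<partial>M)"
proof -
  have "incseq (\<lambda>n w. ennreal (max (- real n) (min (real n) (U w)) - max (- real n) (min (real n) (V w))))"
  proof (intro incseq_SucI le_funI)
    fix n w
    show "ennreal (max (- real n) (min (real n) (U w)) - max (- real n) (min (real n) (V w)))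
      \<le> ennreal (max (- real (Suc n)) (min (real (Suc n)) (U w)) - max (- real (Suc n)) (min (real (Suc n)) (V w)))"
    \<comment> \<open>Monotonicity in \<open>n\<close> holds for the positive parts only: where
      \<open>U w \<le> V w\<close> the clamped difference may decrease, but \<open>ennreal\<close>
      makes it 0.\<close>
    proof (cases "U w \<le> V w")
      case True
      then have "max (- real n) (min (real n) (U w)) - max (- real n) (min (real n) (V w)) \<le> 0" by linarith
      then show ?thesis by (simp add: ennreal_neg)
    qed (intro ennreal_leI clamp_diff_mono, auto)
  qed
  then show ?thesis
    by (subst SUP_clamp_diff[symmetric]) (rule nn_integral_monotone_convergence_SUP, auto)
qed

text \<open>\<open>enn2real\<close> sends infinity to 0, hence the finiteness assumptions.\<close>

lemma eq_if_enn2real_diff_zero: "enn2real a - enn2real b = 0 \<Longrightarrow> a \<noteq> \<infinity> \<Longrightarrow> b \<noteq> \<infinity> \<Longrightarrow> a = b"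
  by (cases a; cases b) auto

text \<open>The clamped variables have equal finite means, and the positive parts of
  the clamped differences increase to those of \<open>U - V\<close>.\<close>

lemma (in prob_space) nn_integral_diff_same_distr:
  fixes U V :: "'a \<Rightarrow> real"
  assumes [measurable]: "U \<in> borel_measurable M" "V \<in> borel_measurable M"
    and same: "distr M borel U = distr M borel V"
  shows "(\<integral>\<^sup>+w. ennreal (U w - V w) \<partial>M) = (\<integral>\<^sup>+w. ennreal (V w - U w) \<partial>M)"
proof -
  have "(\<integral>\<^sup>+w. ennreal (max (- real n) (min (real n) (U w)) - max (- real n) (min (real n) (V w))) \<partial>M)
    = (\<integral>\<^sup>+w. ennreal (max (- real n) (min (real n) (V w)) - max (- real n) (min (real n) (U w))) \<partial>M)" for n
  proof -
    define c where "c t = max (- real n) (min (real n) t)" for t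
    have [measurable]: "c \<in> borel_measurable borel" unfolding c_def by measurable
    have bnd: "norm (c t) \<le> real n" for t unfolding c_def by auto
    have iU: "integrable M (\<lambda>w. c (U w))"
      by (rule integrable_const_bound[of _ "real n"]) (use bnd in auto)
    have iV: "integrable M (\<lambda>w. c (V w))"
      by (rule integrable_const_bound[of _ "real n"]) (use bnd in auto)
    have eq: "(\<integral>w. c (U w) \<partial>M) = (\<integral>w. c (V w) \<partial>M)"
      using integral_distr[of U M borel c] integral_distr[of V M borel c] same by simp
    have i: "integrable M (\<lambda>w. c (U w) - c (V w))" using iU iV by simp
    have i': "integrable M (\<lambda>w. c (V w) - c (U w))" using iU iV by simp
    have fin: "(\<integral>\<^sup>+w. ennreal (c (U w) - c (V w)) \<partial>M) \<noteq> \<infinity>" "(\<integral>\<^sup>+w. ennreal (c (V w) - c (U w)) \<partial>M) \<noteq> \<infinity>"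
      using i i' by (auto simp: real_integrable_def)
    \<comment> \<open>The Bochner integral of \<open>c (U w) - c (V w)\<close> is the integral of
      its positive part minus that of its negative part; it vanishes because the two means
      agree.\<close>
    have "enn2real (\<integral>\<^sup>+w. ennreal (c (U w) - c (V w)) \<partial>M) - enn2real (\<integral>\<^sup>+w. ennreal (c (V w) - c (U w)) \<partial>M) = 0"
      using real_lebesgue_integral_def[OF i] iU iV eq by simp
    then show ?thesis
      using fin eq_if_enn2real_diff_zero unfolding c_def by auto
  qed
  then show ?thesis
    by (simp only: nn_integral_clamp_diff[OF assms(1,2)] nn_integral_clamp_diff[OF assms(2,1)])
qed

section \<open>Joint measurability in time and state\<close>

text \<open>Rounding the time up to a grid of mesh \<open>1 / (n + 1)\<close> leaves countably many
  times, for which measurability is given, and continuity lets the mesh tend to 0.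
  \<open>max 0 s\<close> extends the paths to negative times by their value at 0.\<close>

lemma borel_measurable_continuous_paths:
  fixes g :: "real \<Rightarrow> 'a \<Rightarrow> 'b::metric_space"
  assumes meas: "\<And>s. 0 \<le> s \<Longrightarrow> g s \<in> borel_measurable M"
    and cont: "\<And>w. w \<in> space M \<Longrightarrow> continuous_on {0..} (\<lambda>s. g s w)"
  shows "(\<lambda>(s, w). g (max 0 s) w) \<in> borel_measurable (borel \<Otimes>\<^sub>M M)"
proof (rule borel_measurable_LIMSEQ_metric)
  \<comment> \<open>Index of the first grid point at or after \<open>max 0 s\<close>, so that the
    rounded time overshoots by at most one mesh width and stays nonnegative.\<close>
  define q where "q n s = nat \<lceil>real (Suc n) * max 0 s\<rceil>" for n :: nat and s :: real
  show "(\<lambda>p. g (real (q n (fst p)) / real (Suc n)) (snd p)) \<in> borel_measurable (borel \<Otimes>\<^sub>M M)" for n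
  proof (rule measurable_compose_countable[where f = "\<lambda>i p. g (real i / real (Suc n)) (snd p)"])
    show "(\<lambda>p. g (real i / real (Suc n)) (snd p)) \<in> borel_measurable (borel \<Otimes>\<^sub>M M)" for i :: nat
      by (rule measurable_compose[OF measurable_snd meas]) simp
    show "(\<lambda>p. q n (fst p)) \<in> borel \<Otimes>\<^sub>M M \<rightarrow>\<^sub>M count_space UNIV"
      unfolding q_def by measurable
  qed
  fix p :: "real \<times> 'a" assume p: "p \<in> space (borel \<Otimes>\<^sub>M M)"
  obtain s w where sw: "p = (s, w)" by (cases p)
  have w: "w \<in> space M" using p sw by (auto simp: space_pair_measure)
  have lim: "(\<lambda>n. real (q n s) / real (Suc n)) \<longlonglongrightarrow> max 0 s"
  proof (rule tendsto_sandwich)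
    have b: "real (Suc n) * max 0 s \<le> real (q n s) \<and> real (q n s) \<le> real (Suc n) * max 0 s + 1" for n
    proof -
      have "0 \<le> real (Suc n) * max 0 s" by simp
      then show ?thesis unfolding q_def by (simp del: of_nat_Suc)
    qed
    have "max 0 s \<le> real (q n s) / real (Suc n)" for n
      using b[of n] by (subst pos_le_divide_eq) (simp_all add: mult.commute del: of_nat_Suc)
    then show "\<forall>\<^sub>F n in sequentially. max 0 s \<le> real (q n s) / real (Suc n)"
      by simp
    show "\<forall>\<^sub>F n in sequentially. real (q n s) / real (Suc n) \<le> max 0 s + 1 / real (Suc n)"
      using b by (auto simp: field_simps simp del: of_nat_Suc)
    show "(\<lambda>n. max 0 s + 1 / real (Suc n)) \<longlonglongrightarrow> max 0 s"
      using tendsto_add[OF tendsto_const LIMSEQ_inverse_real_of_nat] by (simp add: inverse_eq_divide)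
  qed simp
  show "(\<lambda>n. g (real (q n (fst p)) / real (Suc n)) (snd p)) \<longlonglongrightarrow> (case p of (s, w) \<Rightarrow> g (max 0 s) w)"
    unfolding sw using continuous_on_tendsto_compose[OF cont[OF w] lim] by simp
qed

text \<open>Integrals of bounded continuous functions are continuous in time and measurable in the
  state, hence jointly measurable. Indicators of closed sets are limits of such functions, and the
  closed sets form an intersection-stable generator.\<close>

lemma measurable_kernel_weakly_continuous:
  fixes P :: "real \<Rightarrow> 'a \<Rightarrow> 'b::metric_space measure"
  assumes P: "\<And>s. 0 \<le> s \<Longrightarrow> P s \<in> M \<rightarrow>\<^sub>M prob_algebra borel"
    and cont: "\<And>(f :: 'b \<Rightarrow> real) x. x \<in> space M \<Longrightarrow> continuous_on UNIV f \<Longrightarrow> (\<And>y. \<bar>f y\<bar> \<le> 1) \<Longrightarrow>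
      continuous_on {0..} (\<lambda>s. \<integral>y. f y \<partial>P s x)"
  shows "(\<lambda>(s, x). P (max 0 s) x) \<in> borel \<Otimes>\<^sub>M M \<rightarrow>\<^sub>M prob_algebra borel"
proof (rule measurable_prob_algebra_generated[of borel UNIV "Collect closed"])
  show "sets (borel :: 'b measure) = sigma_sets UNIV (Collect closed)"
    unfolding borel_eq_closed by simp
  show "Int_stable (Collect closed)" by (auto simp: Int_stable_def)
  show "Collect closed \<subseteq> Pow UNIV" by simp
next
  fix p :: "real \<times> 'a" assume "p \<in> space (borel \<Otimes>\<^sub>M M)"
  then show "prob_space (case p of (s, x) \<Rightarrow> P (max 0 s) x)"
    "sets (case p of (s, x) \<Rightarrow> P (max 0 s) x) = sets borel"
    using measurable_space[OF P] by (auto simp: space_pair_measure space_prob_algebra)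
next
  fix C :: "'b set" assume "C \<in> Collect closed"
  then have C: "closed C" by simp
  show "(\<lambda>p. emeasure (case p of (s, x) \<Rightarrow> P (max 0 s) x) C) \<in> borel_measurable (borel \<Otimes>\<^sub>M M)"
  \<comment> \<open>The distance to the empty set is 0 by convention, so the approximation below
    needs a nonempty \<open>C\<close>.\<close>
  proof (cases "C = {}")
    case False
    \<comment> \<open>Continuous, equal to 1 on \<open>C\<close>, and for \<open>n > 0\<close> equal
      to 0 at distance at least \<open>1 / n\<close> from it. As \<open>C\<close> is closed, every
      point outside has positive distance, so the limit is the indicator.\<close>
    define f where "f n y = max 0 (1 - real n * infdist y C)" for n y
    have fc: "continuous_on UNIV (f n)" for n
      unfolding f_def by (intro continuous_intros)
    have [measurable]: "f n \<in> borel_measurable borel" for n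
      using fc by (rule borel_measurable_continuous_onI)
    have fb: "\<bar>f n y\<bar> \<le> 1" for n y
      unfolding f_def using infdist_nonneg[of y C] by auto
    have lim: "(\<lambda>n. f n y) \<longlonglongrightarrow> indicator C y" for y
    proof (cases "y \<in> C")
      case True then show ?thesis by (simp add: f_def)
    next
      case y: False
      then have pos: "infdist y C > 0" using C False by (simp add: infdist_pos_not_in_closed)
      obtain k :: nat where k: "1 / infdist y C \<le> real k" using real_arch_simple by blast
      have "f n y = 0" if "n \<ge> k" for n
      proof -
        have "1 / infdist y C \<le> real n" using k that by (meson of_nat_mono order_trans)
        then show ?thesis using pos by (simp add: f_def field_simps)
      qed
      then have "\<forall>\<^sub>F n in sequentially. f n y = 0"
        using eventually_sequentially by blast
      then show ?thesis using y by (simp add: tendsto_eventually)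
    qed
    have "(\<lambda>(s, x). measure (P (max 0 s) x) C) \<in> borel_measurable (borel \<Otimes>\<^sub>M M)"
    proof (rule borel_measurable_LIMSEQ_metric)
      fix n
      show "(\<lambda>(s, x). \<integral>y. f n y \<partial>P (max 0 s) x) \<in> borel_measurable (borel \<Otimes>\<^sub>M M)"
      proof (rule borel_measurable_continuous_paths)
        fix s :: real assume "0 \<le> s"
        show "(\<lambda>x. \<integral>y. f n y \<partial>P s x) \<in> borel_measurable M"
          by (rule measurable_compose[OF measurable_prob_algebraD[OF P[OF \<open>0 \<le> s\<close>]]
                integral_measurable_subprob_algebra]) simp
      qed (use cont fc fb in auto)
    next
      fix p :: "real \<times> 'a" assume p: "p \<in> space (borel \<Otimes>\<^sub>M M)"
      obtain s x where sx: "p = (s, x)" by (cases p)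
      have Q: "P (max 0 s) x \<in> space (prob_algebra borel)"
        using p sx measurable_space[OF P, of "max 0 s" x] by (auto simp: space_pair_measure)
      then interpret Q: prob_space "P (max 0 s) x" by (simp add: space_prob_algebra)
      have [measurable_cong]: "sets (P (max 0 s) x) = sets borel" using Q by (simp add: space_prob_algebra)
      have "(\<lambda>n. \<integral>y. f n y \<partial>P (max 0 s) x) \<longlonglongrightarrow> (\<integral>y. indicator C y \<partial>P (max 0 s) x)"
        using borel_closed[OF C] lim fb
        by (intro integral_dominated_convergence[where w = "\<lambda>_. 1"]) (auto intro: borel_measurable_indicator)
      then show "(\<lambda>n. case p of (s, x) \<Rightarrow> \<integral>y. f n y \<partial>P (max 0 s) x)
          \<longlonglongrightarrow> (case p of (s, x) \<Rightarrow> measure (P (max 0 s) x) C)"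
        using C Q sx by (simp add: space_prob_algebra)
    qed
    then have m: "(\<lambda>p. ennreal (case p of (s, x) \<Rightarrow> measure (P (max 0 s) x) C)) \<in> borel_measurable (borel \<Otimes>\<^sub>M M)"
      by measurable
    show ?thesis
    proof (rule measurable_cong[THEN iffD1, OF _ m])
      fix p :: "real \<times> 'a" assume p: "p \<in> space (borel \<Otimes>\<^sub>M M)"
      obtain s x where sx: "p = (s, x)" by (cases p)
      have "P (max 0 s) x \<in> space (prob_algebra borel)"
        using p sx measurable_space[OF P, of "max 0 s" x] by (auto simp: space_pair_measure)
      then interpret Q: prob_space "P (max 0 s) x" by (simp add: space_prob_algebra)
      show "ennreal (case p of (s, x) \<Rightarrow> measure (P (max 0 s) x) C) = emeasure (case p of (s, x) \<Rightarrow> P (max 0 s) x) C"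
        by (simp add: sx Q.emeasure_eq_measure)
    qed
  qed simp
qed

section \<open>Increments over one step of a stationary kernel\<close>

text \<open>The joint law \<open>J\<close> of a start drawn from \<open>\<pi>\<close> and its
  successor under \<open>Q\<close> has both marginals equal to \<open>\<pi>\<close>. Thus
  \<open>f\<close> of the two coordinates has the same law, and
  \<open>nn_integral_diff_same_distr\<close> applies without integrability of
  \<open>f\<close>.\<close>

lemma stationary_nn_integral_diff:
  fixes f :: "'a \<Rightarrow> real"
  assumes \<pi>: "\<pi> \<in> space (prob_algebra N)" and Q: "Q \<in> N \<rightarrow>\<^sub>M prob_algebra N"
    and inv: "\<pi> \<bind> Q = \<pi>" and f[measurable]: "f \<in> borel_measurable N"
  shows "(\<integral>\<^sup>+x. \<integral>\<^sup>+y. ennreal (f y - f x) \<partial>Q x \<partial>\<pi>) = (\<integral>\<^sup>+x. \<integral>\<^sup>+y. ennreal (f x - f y) \<partial>Q x \<partial>\<pi>)"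
proof -
  interpret \<pi>: prob_space \<pi> using \<pi> by (simp add: space_prob_algebra)
  have s\<pi>[measurable_cong]: "sets \<pi> = sets N" using \<pi> by (simp add: space_prob_algebra)
  have Qs[measurable]: "Q \<in> N \<rightarrow>\<^sub>M subprob_algebra N" using Q by (rule measurable_prob_algebraD)
  \<comment> \<open>The kernel that keeps the starting point: \<open>K x\<close> is the law of the
    pair \<open>(x, y)\<close> with \<open>y\<close> drawn from \<open>Q x\<close>.\<close>
  define K where "K x = distr (Q x) (N \<Otimes>\<^sub>M N) (Pair x)" for x
  have K[measurable]: "K \<in> N \<rightarrow>\<^sub>M subprob_algebra (N \<Otimes>\<^sub>M N)"
    unfolding K_def by (rule measurable_distr2[OF _ Qs]) (simp add: id_def[symmetric] split_def)
  have Ks: "K \<in> \<pi> \<rightarrow>\<^sub>M subprob_algebra (N \<Otimes>\<^sub>M N)" by measurable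
  have Qx: "prob_space (Q x)" "sets (Q x) = sets N" if "x \<in> space N" for x
    using measurable_space[OF Q that] by (auto simp: space_prob_algebra)
  define J where "J = \<pi> \<bind> K"
  have sJ[measurable_cong]: "sets J = sets (N \<Otimes>\<^sub>M N)"
    unfolding J_def by (rule sets_bind_measurable[OF Ks]) (rule \<pi>.not_empty)
  have sp: "space \<pi> = space N" using s\<pi> by (rule sets_eq_imp_space_eq)
  have Pm: "Pair x \<in> Q x \<rightarrow>\<^sub>M N \<Otimes>\<^sub>M N" if "x \<in> space N" for x
    using Qx(2)[OF that] that by (simp cong: measurable_cong_sets)
  have "distr J N snd = \<pi> \<bind> (\<lambda>x. distr (K x) N snd)"
    unfolding J_def by (rule distr_bind[OF Ks \<pi>.not_empty]) simp
  also have "\<dots> = \<pi> \<bind> Q"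
  proof (rule bind_cong[OF refl])
    fix x assume "x \<in> space \<pi>"
    then have x: "x \<in> space N" using sp by simp
    have "distr (K x) N snd = distr (Q x) N (\<lambda>y. y)"
      unfolding K_def by (subst distr_distr) (auto simp: Pm[OF x] comp_def)
    also have "\<dots> = Q x" using Qx(2)[OF x] by (intro distr_id2) simp
    finally show "distr (K x) N snd = Q x" .
  qed
  finally have J2: "distr J N snd = \<pi>" using inv by simp
  have "distr J N fst = \<pi> \<bind> (\<lambda>x. distr (K x) N fst)"
    unfolding J_def by (rule distr_bind[OF Ks \<pi>.not_empty]) simp
  also have "\<dots> = \<pi> \<bind> return N"
  proof (rule bind_cong[OF refl])
    fix x assume "x \<in> space \<pi>"
    then have x: "x \<in> space N" using sp by simp
    interpret Qx: prob_space "Q x" using Qx(1)[OF x] .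
    show "distr (K x) N fst = return N x"
      unfolding K_def by (subst distr_distr) (auto simp: Pm[OF x] comp_def x)
  qed
  also have "\<dots> = \<pi>" by (rule bind_return'') (rule s\<pi>)
  finally have J1: "distr J N fst = \<pi>" .
  interpret J: prob_space J
  proof (rule prob_space_distrD[of fst J N])
    show "fst \<in> J \<rightarrow>\<^sub>M N" by measurable
    show "prob_space (distr J N fst)" unfolding J1 by unfold_locales (rule \<pi>.emeasure_space_1)
  qed
  have same: "distr J borel (\<lambda>p. f (snd p)) = distr J borel (\<lambda>p. f (fst p))"
    using distr_distr[of f N borel snd J] distr_distr[of f N borel fst J] J1 J2 by (simp add: comp_def)
  \<comment> \<open>Disintegration of \<open>J\<close>: first integrate over the successor, then
    over the start.\<close>
  have eval: "(\<integral>\<^sup>+p. g (fst p) (snd p) \<partial>J) = (\<integral>\<^sup>+x. \<integral>\<^sup>+y. g x y \<partial>Q x \<partial>\<pi>)"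
    if [measurable]: "(\<lambda>p. g (fst p) (snd p)) \<in> borel_measurable (N \<Otimes>\<^sub>M N)" for g :: "'a \<Rightarrow> 'a \<Rightarrow> ennreal"
  proof -
    have "(\<integral>\<^sup>+p. g (fst p) (snd p) \<partial>J) = (\<integral>\<^sup>+x. \<integral>\<^sup>+p. g (fst p) (snd p) \<partial>K x \<partial>\<pi>)"
      unfolding J_def by (rule nn_integral_bind[OF that Ks])
    also have "\<dots> = (\<integral>\<^sup>+x. \<integral>\<^sup>+y. g x y \<partial>Q x \<partial>\<pi>)"
      by (rule nn_integral_cong) (simp add: K_def nn_integral_distr Pm sp)
    finally show ?thesis .
  qed
  show ?thesis
    using J.nn_integral_diff_same_distr[OF _ _ same] eval[of "\<lambda>x y. ennreal (f y - f x)"] eval[of "\<lambda>x y. ennreal (f x - f y)"]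
    by simp
qed

section \<open>Brownian motion and solution paths on the unit time interval\<close>

text \<open>Since \<open>W 0\<close> vanishes almost surely, \<open>W 1\<close> is an increment with
  standard normal components. The bound on the absolute moment depends on \<open>v\<close> alone,
  which later makes it uniform over all starting points.\<close>

lemma brownian_motion_linear_unit_time:
  fixes W :: "real \<Rightarrow> 'w \<Rightarrow> real^'m"
  assumes bm: "brownian_motion M F W"
  shows "integrable M (\<lambda>w. v \<bullet> W 1 w)" (is ?int)
    and "(\<integral>w. v \<bullet> W 1 w \<partial>M) = 0" (is ?mean)
    and "(\<integral>w. \<bar>v \<bullet> W 1 w\<bar> \<partial>M) \<le> (\<Sum>i\<in>UNIV. \<bar>v $ i\<bar>) * sqrt (2 / pi)" (is ?abs)
proof -
  interpret prob_space M using bm by (simp add: brownian_motion_def)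
  define Z where "Z i w = (W 1 w - W 0 w) $ i" for i w
  have Z: "distributed M lborel (Z i) (normal_density 0 1)" for i
  proof -
    have "\<forall>i. distributed M lborel (\<lambda>w. (W 1 w - W 0 w) $ i) (normal_density 0 (sqrt (1 - 0)))"
      using bm unfolding brownian_motion_def by (meson order_refl zero_less_one)
    then show ?thesis by (simp add: Z_def[abs_def])
  qed
  have iZ: "integrable M (Z i)" for i
    by (rule distributed_integrable_var[OF Z]) (use integrable_normal_moment_nz_1[of 1 0] in auto)
  have mZ: "(\<integral>w. Z i w \<partial>M) = 0" for i
    using standard_normal_distributed_expectation[OF Z] .
  \<comment> \<open>First absolute moment of a standard normal variable, the case
    \<open>k = 0\<close> of the formula for the moments of order \<open>2 * k + 1\<close>.\<close>
  have aZ: "(\<integral>w. \<bar>Z i w\<bar> \<partial>M) = sqrt (2 / pi)" for i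
    using distributed_integral[OF Z, of abs i] integral_std_normal_moment_abs_odd[of 0] by simp
  have "AE w in M. W 0 w = 0" using bm by (auto simp: brownian_motion_def)
  then have ae: "AE w in M. v \<bullet> W 1 w = (\<Sum>i\<in>UNIV. v $ i * Z i w)"
    by eventually_elim (simp add: Z_def inner_vec_def)
  have Wm: "W 1 \<in> borel_measurable M"
    using bm measurable_from_subalg[of M "F 1" "W 1" borel] by (auto simp: brownian_motion_def)
  then have [measurable]: "(\<lambda>w. v \<bullet> W 1 w) \<in> borel_measurable M" by simp
  have iS: "integrable M (\<lambda>w. \<Sum>i\<in>UNIV. v $ i * Z i w)" using iZ by simp
  then have Sm[measurable]: "(\<lambda>w. \<Sum>i\<in>UNIV. v $ i * Z i w) \<in> borel_measurable M" by simp
  show ?int using iS integrable_cong_AE[OF _ Sm ae] by simp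
  have "(\<integral>w. v \<bullet> W 1 w \<partial>M) = (\<integral>w. (\<Sum>i\<in>UNIV. v $ i * Z i w) \<partial>M)"
    by (rule integral_cong_AE) (use ae in auto)
  then show ?mean using iZ mZ by simp
  have "(\<integral>w. \<bar>v \<bullet> W 1 w\<bar> \<partial>M) = (\<integral>w. \<bar>\<Sum>i\<in>UNIV. v $ i * Z i w\<bar> \<partial>M)"
    by (rule integral_cong_AE) (use ae in auto)
  also have "\<dots> \<le> (\<integral>w. (\<Sum>i\<in>UNIV. \<bar>v $ i\<bar> * \<bar>Z i w\<bar>) \<partial>M)"
    using iZ iS by (intro integral_mono) (auto intro!: order_trans[OF sum_abs] simp: abs_mult)
  also have "\<dots> = (\<Sum>i\<in>UNIV. \<bar>v $ i\<bar>) * sqrt (2 / pi)"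
    using iZ aZ by (simp add: sum_distrib_right)
  finally show ?abs .
qed

lemma sde_solution_measurable:
  assumes "sde_solution f \<sigma> x M F W X" "0 \<le> t"
  shows "X t \<in> borel_measurable M"
  using assms measurable_from_subalg[of M "F t" "X t" borel]
  by (auto simp: sde_solution_def brownian_motion_def)

text \<open>Tonelli along the path. Paths are continuous only almost surely and \<open>M\<close>
  need not be complete, so the path integral itself may fail to be measurable; \<open>I\<close> is a
  measurable version of it.\<close>

lemma sde_solution_nn_integral_path:
  fixes X :: "real \<Rightarrow> 'w \<Rightarrow> real^'m" and h :: "real^'m \<Rightarrow> ennreal"
  assumes sde: "sde_solution f \<sigma> x M F W X" and h[measurable]: "h \<in> borel_measurable borel"
  obtains I where "I \<in> borel_measurable M"
    and "AE w in M. I w = (\<integral>\<^sup>+s. indicator {0..1} s * h (X s w) \<partial>lborel)"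
    and "(\<integral>\<^sup>+w. I w \<partial>M) = (\<integral>\<^sup>+s. indicator {0..1} s * (\<integral>\<^sup>+w. h (X s w) \<partial>M) \<partial>lborel)"
proof -
  interpret prob_space M using sde by (simp add: sde_solution_def brownian_motion_def)
  note Xm = sde_solution_measurable[OF sde]
  have "AE w in M. continuous_on {0..} (\<lambda>t. X t w)" using sde by (auto simp: sde_solution_def)
  then obtain N where N: "{w \<in> space M. \<not> continuous_on {0..} (\<lambda>t. X t w)} \<subseteq> N" "N \<in> null_sets M"
    by (auto elim!: AE_E simp: null_sets_def)
  have [measurable]: "N \<in> sets M" using N by auto
  \<comment> \<open>Resetting the path to 0 on a measurable null set that covers the discontinuous
    paths makes every path continuous, as joint measurability requires.\<close>
  define X' where "X' s w = (if w \<in> N then 0 else X s w)" for s w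
  have "(\<lambda>(s, w). X' (max 0 s) w) \<in> borel_measurable (borel \<Otimes>\<^sub>M M)"
  proof (rule borel_measurable_continuous_paths)
    fix s :: real assume "0 \<le> s"
    then have [measurable]: "X s \<in> borel_measurable M" by (rule Xm)
    show "X' s \<in> borel_measurable M" unfolding X'_def by measurable
  next
    fix w assume "w \<in> space M"
    then show "continuous_on {0..} (\<lambda>s. X' s w)" using N by (cases "w \<in> N") (auto simp: X'_def)
  qed
  then have X'm[measurable]: "(\<lambda>(s, w). X' (max 0 s) w) \<in> borel_measurable (lborel \<Otimes>\<^sub>M M)"
    by (simp cong: measurable_cong_sets)
  have aeN: "AE w in M. w \<notin> N" using N(2) by (rule AE_not_in)
  define I where "I w = (\<integral>\<^sup>+s. indicator {0..1} s * h (X' (max 0 s) w) \<partial>lborel)" for w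
  interpret pair_sigma_finite lborel M ..
  have m: "(\<lambda>(s, w). indicator {0..1} s * h (X' (max 0 s) w)) \<in> borel_measurable (lborel \<Otimes>\<^sub>M M)"
    using X'm by measurable
  have eq: "indicator {0..1} s * h (X' (max 0 s) w) = indicator {0..1} s * h (X s w)"
    if "w \<notin> N" for s w
    using that by (auto simp: X'_def indicator_def)
  show thesis
  proof
    show "I \<in> borel_measurable M"
      unfolding I_def using measurable_pair_swap[OF m] by (intro lborel.borel_measurable_nn_integral) simp
    show "AE w in M. I w = (\<integral>\<^sup>+s. indicator {0..1} s * h (X s w) \<partial>lborel)"
      using aeN by eventually_elim (simp add: I_def eq)
    have "(\<integral>\<^sup>+w. I w \<partial>M) = (\<integral>\<^sup>+s. (\<integral>\<^sup>+w. indicator {0..1} s * h (X' (max 0 s) w) \<partial>M) \<partial>lborel)"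
      unfolding I_def using m by (rule Fubini')
    also have "\<dots> = (\<integral>\<^sup>+s. indicator {0..1} s * (\<integral>\<^sup>+w. h (X s w) \<partial>M) \<partial>lborel)"
    proof (rule nn_integral_cong)
      fix s :: real
      show "(\<integral>\<^sup>+w. indicator {0..1} s * h (X' (max 0 s) w) \<partial>M) = indicator {0..1} s * (\<integral>\<^sup>+w. h (X s w) \<partial>M)"
      proof (cases "s \<in> {0..1}")
        case True
        have "(\<integral>\<^sup>+w. h (X' (max 0 s) w) \<partial>M) = (\<integral>\<^sup>+w. h (X s w) \<partial>M)"
          by (rule nn_integral_cong_AE) (use aeN True in \<open>auto simp: X'_def\<close>)
        then show ?thesis using True by simp
      qed simp
    qed
    finally show "(\<integral>\<^sup>+w. I w \<partial>M) = (\<integral>\<^sup>+s. indicator {0..1} s * (\<integral>\<^sup>+w. h (X s w) \<partial>M) \<partial>lborel)" .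
  qed
qed

text \<open>The equation for \<open>d\<close> with negative terms moved across, so that it can be
  integrated in \<open>ennreal\<close> even where an integral may be infinite.\<close>

lemma ennreal_parts_balance:
  assumes "d = i + n - r" "0 \<le> i" "0 \<le> r"
  shows "ennreal d + ennreal r + ennreal (- n) = ennreal (- d) + ennreal i + ennreal n"
proof -
  have p: "ennreal t = ennreal (max 0 t)" for t by (simp add: max_def ennreal_neg)
  have "ennreal d + ennreal r + ennreal (- n) = ennreal (max 0 d + r + max 0 (- n))"
    using assms by (subst (1 3) p) simp
  also have "max 0 d + r + max 0 (- n) = max 0 (- d) + i + max 0 n"
    using assms by (auto simp: max_def)
  also have "ennreal \<dots> = ennreal (- d) + ennreal i + ennreal n"
    using assms by (subst (2 4) p) simp
  finally show ?thesis .
qed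

text \<open>The increment of \<open>a \<bullet> X\<close> over unit time is the path integral of
  \<open>h\<close>, minus \<open>r\<close>, plus a centered Gaussian term. Taking expectations
  removes that term. Since \<open>h\<close> is nonnegative, only \<open>r\<close> and the Gaussian
  term can push the increment below 0, whence a bound independent of \<open>x\<close>.\<close>

lemma sde_solution_linear_functional:
  fixes X :: "real \<Rightarrow> 'w \<Rightarrow> real^'m" and h :: "real^'m \<Rightarrow> real"
  assumes sde: "sde_solution f \<sigma> x M F W X"
    and h[measurable]: "h \<in> borel_measurable borel" and h0: "\<And>y. 0 \<le> h y"
    and drift: "\<And>y. a \<bullet> f y = h y - r" and r: "0 \<le> r"
  shows "(\<integral>\<^sup>+w. ennreal (a \<bullet> X 1 w - a \<bullet> x) \<partial>M) + ennreal r =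
      (\<integral>\<^sup>+w. ennreal (a \<bullet> x - a \<bullet> X 1 w) \<partial>M)
      + (\<integral>\<^sup>+s. indicator {0..1} s * (\<integral>\<^sup>+w. ennreal (h (X s w)) \<partial>M) \<partial>lborel)" (is ?balance)
    and "(\<integral>\<^sup>+w. ennreal (a \<bullet> x - a \<bullet> X 1 w) \<partial>M)
      \<le> ennreal (r + (\<Sum>i\<in>UNIV. \<bar>(a v* \<sigma>) $ i\<bar>) * sqrt (2 / pi))" (is ?bound)
proof -
  have bm: "brownian_motion M F W" using sde by (simp add: sde_solution_def)
  then interpret prob_space M by (simp add: brownian_motion_def)
  have [measurable]: "X 1 \<in> borel_measurable M" using sde_solution_measurable[OF sde] by simp
  \<comment> \<open>The noise term: \<open>a v* \<sigma>\<close> is the transpose of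
    \<open>\<sigma>\<close> applied to \<open>a\<close>.\<close>
  define n where "n w = (a v* \<sigma>) \<bullet> W 1 w" for w
  note n = brownian_motion_linear_unit_time[OF bm, of "a v* \<sigma>", folded n_def]
  have [measurable]: "n \<in> borel_measurable M" using n(1) by simp
  obtain I where [measurable]: "I \<in> borel_measurable M"
    and I: "AE w in M. I w = (\<integral>\<^sup>+s. indicator {0..1} s * ennreal (h (X s w)) \<partial>lborel)"
    and II: "(\<integral>\<^sup>+w. I w \<partial>M) = (\<integral>\<^sup>+s. indicator {0..1} s * (\<integral>\<^sup>+w. ennreal (h (X s w)) \<partial>M) \<partial>lborel)"
    by (rule sde_solution_nn_integral_path[OF sde, of "\<lambda>y. ennreal (h y)"]) auto
  have "AE w in M. continuous_on {0..} (\<lambda>t. X t w) \<and>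
        (\<forall>t\<ge>0. set_integrable lborel {0..t} (\<lambda>s. f (X s w)) \<and>
               X t w = x + (LINT s:{0..t}|lborel. f (X s w)) + \<sigma> *v W t w)"
    using sde unfolding sde_solution_def by blast
  then have "AE w in M. set_integrable lborel {0..1} (\<lambda>s. f (X s w)) \<and>
               X 1 w = x + (LINT s:{0..1}|lborel. f (X s w)) + \<sigma> *v W 1 w"
    by (rule eventually_mono) auto
  with I have ae: "AE w in M. \<exists>i\<ge>0. I w = ennreal i \<and> a \<bullet> X 1 w - a \<bullet> x = i + n w - r"
  proof eventually_elim
    case (elim w)
    have int: "integrable lborel (\<lambda>s. indicator {0..1} s *\<^sub>R f (X s w))"
      using elim by (simp add: set_integrable_def)
    have e: "a \<bullet> (indicator {0..1} s *\<^sub>R f (X s w)) = indicator {0..1} s * h (X s w) - r * indicator {0..1} s" for s :: real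
      by (simp add: drift algebra_simps)
    have ind: "integrable lborel (\<lambda>s::real. r * indicator {0..1} s)" by simp
    have "integrable lborel (\<lambda>s. a \<bullet> (indicator {0..1} s *\<^sub>R f (X s w)))"
      using int by (rule integrable_inner_right)
    then have d: "integrable lborel (\<lambda>s. indicator {0..1} s * h (X s w) - r * indicator {0..1} s)"
      unfolding e .
    \<comment> \<open>A solution has integrable drift along its path, and \<open>h\<close> differs
      from \<open>a \<bullet> f\<close> by the constant \<open>r\<close>, so \<open>h\<close> is
      integrable on the unit time interval.\<close>
    have ih: "integrable lborel (\<lambda>s. indicator {0..1} s * h (X s w))"
      using Bochner_Integration.integrable_add[OF d ind] by simp
    have "a \<bullet> (LINT s:{0..1}|lborel. f (X s w)) = (\<integral>s. a \<bullet> (indicator {0..1} s *\<^sub>R f (X s w)) \<partial>lborel)"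
      unfolding set_lebesgue_integral_def using int by (subst integral_inner_right) auto
    also have "\<dots> = (\<integral>s. indicator {0..1} s * h (X s w) \<partial>lborel) - r"
      unfolding e using ih ind by (subst Bochner_Integration.integral_diff) auto
    finally have 1: "a \<bullet> (LINT s:{0..1}|lborel. f (X s w)) = (\<integral>s. indicator {0..1} s * h (X s w) \<partial>lborel) - r" .
    have "I w = (\<integral>\<^sup>+s. ennreal (indicator {0..1} s * h (X s w)) \<partial>lborel)"
      using elim(1) h0 by (auto intro!: nn_integral_cong simp: indicator_def)
    also have "\<dots> = ennreal (\<integral>s. indicator {0..1} s * h (X s w) \<partial>lborel)"
      using ih h0 by (intro nn_integral_eq_integral) auto
    finally have 2: "I w = ennreal (\<integral>s. indicator {0..1} s * h (X s w) \<partial>lborel)" .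
    have "a \<bullet> (\<sigma> *v W 1 w) = n w" unfolding n_def by (simp add: dot_lmul_matrix)
    then have "a \<bullet> X 1 w - a \<bullet> x = (\<integral>s. indicator {0..1} s * h (X s w) \<partial>lborel) + n w - r"
      using elim(2) 1 by (simp add: inner_add_right)
    then show ?case using 2 h0 by (intro exI[of _ "\<integral>s. indicator {0..1} s * h (X s w) \<partial>lborel"]) auto
  qed
  have nfin: "(\<integral>\<^sup>+w. ennreal (n w) \<partial>M) \<noteq> \<infinity>" "(\<integral>\<^sup>+w. ennreal (- n w) \<partial>M) \<noteq> \<infinity>"
    using n(1) by (auto simp: real_integrable_def)
  have neq: "(\<integral>\<^sup>+w. ennreal (n w) \<partial>M) = (\<integral>\<^sup>+w. ennreal (- n w) \<partial>M)"
    using real_lebesgue_integral_def[OF n(1)] n(2) nfin by (intro eq_if_enn2real_diff_zero) auto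
  have "(\<integral>\<^sup>+w. ennreal (a \<bullet> X 1 w - a \<bullet> x) + ennreal r + ennreal (- n w) \<partial>M)
    = (\<integral>\<^sup>+w. ennreal (a \<bullet> x - a \<bullet> X 1 w) + I w + ennreal (n w) \<partial>M)"
  proof (rule nn_integral_cong_AE, use ae in eventually_elim)
    case (elim w)
    then obtain i where i: "0 \<le> i" "I w = ennreal i" "a \<bullet> X 1 w - a \<bullet> x = i + n w - r" by blast
    show ?case using ennreal_parts_balance[OF i(3,1) r] i(2) by simp
  qed
  \<comment> \<open>The positive and negative parts of the noise have the same finite mean, so they
    cancel from the two sides.\<close>
  then have "(\<integral>\<^sup>+w. ennreal (n w) \<partial>M) + ((\<integral>\<^sup>+w. ennreal (a \<bullet> X 1 w - a \<bullet> x) \<partial>M) + ennreal r)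
    = (\<integral>\<^sup>+w. ennreal (n w) \<partial>M) + ((\<integral>\<^sup>+w. ennreal (a \<bullet> x - a \<bullet> X 1 w) \<partial>M) + (\<integral>\<^sup>+w. I w \<partial>M))"
    by (simp add: nn_integral_add neq emeasure_space_1 add.commute)
  then show ?balance
    using nfin(1) unfolding ennreal_add_left_cancel II by simp
  have "(\<integral>\<^sup>+w. ennreal (a \<bullet> x - a \<bullet> X 1 w) \<partial>M) \<le> (\<integral>\<^sup>+w. ennreal (r + \<bar>n w\<bar>) \<partial>M)"
    by (rule nn_integral_mono_AE, use ae in eventually_elim) (auto intro!: ennreal_leI)
  also have "\<dots> = ennreal (\<integral>w. r + \<bar>n w\<bar> \<partial>M)"
    using n(1) r by (intro nn_integral_eq_integral) auto
  also have "(\<integral>w. r + \<bar>n w\<bar> \<partial>M) = r + (\<integral>w. \<bar>n w\<bar> \<partial>M)"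
    using n(1) by (simp add: prob_space)
  also have "ennreal \<dots> \<le> ennreal (r + (\<Sum>i\<in>UNIV. \<bar>(a v* \<sigma>) $ i\<bar>) * sqrt (2 / pi))"
    using n(3) by (intro ennreal_leI) simp
  finally show ?bound .
qed

text \<open>Almost sure continuity of the paths and dominated convergence with the constant
  \<open>B\<close>.\<close>

lemma sde_solution_weakly_continuous:
  fixes X :: "real \<Rightarrow> 'w \<Rightarrow> real^'m" and g :: "real^'m \<Rightarrow> real"
  assumes sde: "sde_solution f \<sigma> x M F W X"
    and g: "continuous_on UNIV g" and bound: "\<And>y. \<bar>g y\<bar> \<le> B"
  shows "continuous_on {0..} (\<lambda>s. \<integral>y. g y \<partial>distr M borel (X s))"
proof -
  interpret prob_space M using sde by (simp add: sde_solution_def brownian_motion_def)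
  note Xm = sde_solution_measurable[OF sde]
  have gm[measurable]: "g \<in> borel_measurable borel" using g by (rule borel_measurable_continuous_onI)
  have "continuous_on {0..} (\<lambda>s. \<integral>w. g (X s w) \<partial>M)"
    unfolding continuous_on_sequentially
  proof safe
    fix q :: "nat \<Rightarrow> real" and s :: real
    assume s: "0 \<le> s" and q: "\<forall>n. q n \<in> {0..}" "q \<longlonglongrightarrow> s"
    have "AE w in M. continuous_on {0..} (\<lambda>t. X t w)" using sde by (auto simp: sde_solution_def)
    then have "AE w in M. (\<lambda>n. g (X (q n) w)) \<longlonglongrightarrow> g (X s w)"
    proof eventually_elim
      case (elim w)
      have "(\<lambda>n. X (q n) w) \<longlonglongrightarrow> X s w"
        by (rule continuous_on_tendsto_compose[OF elim q(2)]) (use s q in auto)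
      then show ?case using continuous_on_tendsto_compose[OF g] by auto
    qed
    moreover have "(\<lambda>w. g (X t w)) \<in> borel_measurable M" if "0 \<le> t" for t
      by (rule measurable_compose[OF Xm[OF that] gm])
    ultimately have "(\<lambda>n. \<integral>w. g (X (q n) w) \<partial>M) \<longlonglongrightarrow> (\<integral>w. g (X s w) \<partial>M)"
      using bound q(1) s by (intro integral_dominated_convergence[where w = "\<lambda>_. B"]) simp_all
    then show "((\<lambda>s. \<integral>w. g (X s w) \<partial>M) \<circ> q) \<longlonglongrightarrow> (\<integral>w. g (X s w) \<partial>M)"
      by (simp add: comp_def)
  qed
  then show ?thesis
    by (rule continuous_on_eq) (simp add: integral_distr[OF Xm gm])
qed

section \<open>Mean of the drift under the invariant measure\<close>

text \<open>The balance for a fixed start is integrated over \<open>\<pi>\<close>. By stationarity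
  the upward and downward mean increments agree; being finite, they cancel, and \<open>r\<close> is
  left equal to the time average of \<open>h\<close>, whose mean under \<open>\<pi>\<close> is the
  integral of \<open>h\<close>.\<close>

lemma integral_stationary_drift:
  fixes X :: "real^'m \<Rightarrow> real \<Rightarrow> 'w \<Rightarrow> real^'m" and h :: "real^'m \<Rightarrow> real"
  assumes sde: "\<And>x. sde_solution f \<sigma> x (M x) (F x) (W x) (X x)"
    and inv: "invariant_prob_measure (\<lambda>t x. distr (M x) borel (X x t)) \<pi>"
    and h[measurable]: "h \<in> borel_measurable borel" and h0: "\<And>y. 0 \<le> h y"
    and drift: "\<And>y. a \<bullet> f y = h y - r" and r: "0 \<le> r"
  shows "(\<integral>x. h x \<partial>\<pi>) = r"
proof -
  define P where "P t x = distr (M x) borel (X x t)" for t x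
  have \<pi>: "\<pi> \<in> space (prob_algebra borel)"
    and P: "\<And>t. 0 \<le> t \<Longrightarrow> P t \<in> borel \<rightarrow>\<^sub>M prob_algebra borel"
    and inv: "\<And>t. 0 \<le> t \<Longrightarrow> \<pi> \<bind> P t = \<pi>"
    using inv by (auto simp: invariant_prob_measure_def P_def[abs_def])
  interpret \<pi>: prob_space \<pi> using \<pi> by (simp add: space_prob_algebra)
  have s\<pi>[measurable_cong]: "sets \<pi> = sets borel" using \<pi> by (simp add: space_prob_algebra)
  have Pint: "(\<integral>\<^sup>+y. g y \<partial>P t x) = (\<integral>\<^sup>+w. g (X x t w) \<partial>M x)"
    if "0 \<le> t" "g \<in> borel_measurable borel" for t x and g :: "real^'m \<Rightarrow> ennreal"
    unfolding P_def using that sde_solution_measurable[OF sde] by (simp add: nn_integral_distr)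
  \<comment> \<open>Each start \<open>x\<close> has its own probability space, so joint
    measurability in time and start is obtained from the transition kernels, by weak continuity in
    time.\<close>
  have jm: "(\<lambda>(s, x). P (max 0 s) x) \<in> borel \<Otimes>\<^sub>M borel \<rightarrow>\<^sub>M prob_algebra borel"
    by (rule measurable_kernel_weakly_continuous[OF P])
      (auto simp: P_def intro: sde_solution_weakly_continuous[OF sde])
  have hm: "(\<lambda>p. \<integral>\<^sup>+y. ennreal (h y) \<partial>(case p of (s, x) \<Rightarrow> P (max 0 s) x)) \<in> borel_measurable (borel \<Otimes>\<^sub>M borel)"
    by (rule measurable_compose[OF measurable_prob_algebraD[OF jm] nn_integral_measurable_subprob_algebra]) simp
  have "sets (lborel \<Otimes>\<^sub>M \<pi>) = sets (borel \<Otimes>\<^sub>M borel)"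
    by (intro sets_pair_measure_cong s\<pi>) simp
  then have [measurable]: "(\<lambda>p. \<integral>\<^sup>+y. ennreal (h y) \<partial>(P (max 0 (fst p)) (snd p))) \<in> borel_measurable (lborel \<Otimes>\<^sub>M \<pi>)"
    using hm by (simp add: split_def cong: measurable_cong_sets)
  define H where "H s x = indicator {0..1} s * (\<integral>\<^sup>+y. ennreal (h y) \<partial>P (max 0 s) x)" for s :: real and x
  have Hm: "(\<lambda>(s, x). H s x) \<in> borel_measurable (lborel \<Otimes>\<^sub>M \<pi>)"
    unfolding H_def split_def by measurable
  interpret pair_sigma_finite lborel \<pi> ..
  have HX: "H s x = indicator {0..1} s * (\<integral>\<^sup>+w. ennreal (h (X x s w)) \<partial>M x)" for s x
    by (cases "s \<in> {0..1}") (simp_all add: H_def Pint)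
  have Hswap: "(\<lambda>x. \<integral>\<^sup>+s. H s x \<partial>lborel) \<in> borel_measurable \<pi>"
    using measurable_pair_swap[OF Hm] by (intro lborel.borel_measurable_nn_integral) simp
  have "(\<integral>\<^sup>+x. \<integral>\<^sup>+s. H s x \<partial>lborel \<partial>\<pi>) = (\<integral>\<^sup>+s. \<integral>\<^sup>+x. H s x \<partial>\<pi> \<partial>lborel)"
    using Hm by (rule Fubini')
  \<comment> \<open>By invariance the law at each time is again \<open>\<pi>\<close>, so the inner
    integral is constant on the time interval, which has length 1.\<close>
  also have "\<dots> = (\<integral>\<^sup>+s. (\<integral>\<^sup>+x. ennreal (h x) \<partial>\<pi>) * indicator {0..1::real} s \<partial>lborel)"
  proof (rule nn_integral_cong)
    fix s :: real
    have Ps: "P (max 0 s) \<in> \<pi> \<rightarrow>\<^sub>M subprob_algebra borel"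
      using measurable_prob_algebraD[OF P] by (simp cong: measurable_cong_sets)
    have "(\<integral>\<^sup>+x. H s x \<partial>\<pi>) = indicator {0..1} s * (\<integral>\<^sup>+x. \<integral>\<^sup>+y. ennreal (h y) \<partial>P (max 0 s) x \<partial>\<pi>)"
      unfolding H_def
      by (rule nn_integral_cmult) (rule measurable_compose[OF Ps nn_integral_measurable_subprob_algebra], simp)
    also have "(\<integral>\<^sup>+x. \<integral>\<^sup>+y. ennreal (h y) \<partial>P (max 0 s) x \<partial>\<pi>) = (\<integral>\<^sup>+x. ennreal (h x) \<partial>(\<pi> \<bind> P (max 0 s)))"
      by (rule nn_integral_bind[symmetric, OF _ Ps]) simp
    also have "\<pi> \<bind> P (max 0 s) = \<pi>" by (rule inv) simp
    finally show "(\<integral>\<^sup>+x. H s x \<partial>\<pi>) = (\<integral>\<^sup>+x. ennreal (h x) \<partial>\<pi>) * indicator {0..1} s"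
      by (simp add: mult.commute)
  qed
  also have "\<dots> = (\<integral>\<^sup>+x. ennreal (h x) \<partial>\<pi>)"
    by (simp add: nn_integral_cmult_indicator)
  finally have Hint: "(\<integral>\<^sup>+x. \<integral>\<^sup>+s. H s x \<partial>lborel \<partial>\<pi>) = (\<integral>\<^sup>+x. ennreal (h x) \<partial>\<pi>)" .

  define up where "up x = (\<integral>\<^sup>+y. ennreal (a \<bullet> y - a \<bullet> x) \<partial>P 1 x)" for x
  define dn where "dn x = (\<integral>\<^sup>+y. ennreal (a \<bullet> x - a \<bullet> y) \<partial>P 1 x)" for x
  have P1: "P 1 \<in> borel \<rightarrow>\<^sub>M subprob_algebra borel" using measurable_prob_algebraD[OF P] by simp
  have [measurable]: "up \<in> borel_measurable borel" "dn \<in> borel_measurable borel"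
    unfolding up_def dn_def by (rule nn_integral_measurable_subprob_algebra2[OF _ P1], measurable)+
  have balance: "up x + ennreal r = dn x + (\<integral>\<^sup>+s. H s x \<partial>lborel)" for x
    using sde_solution_linear_functional(1)[OF sde h h0 drift r, of x]
    by (simp add: up_def dn_def Pint HX)
  have "dn x \<le> ennreal (r + (\<Sum>i\<in>UNIV. \<bar>(a v* \<sigma>) $ i\<bar>) * sqrt (2 / pi))" for x
    using sde_solution_linear_functional(2)[OF sde h h0 drift r, of x]
    by (simp add: dn_def Pint)
  then have "(\<integral>\<^sup>+x. dn x \<partial>\<pi>) \<le> (\<integral>\<^sup>+x. ennreal (r + (\<Sum>i\<in>UNIV. \<bar>(a v* \<sigma>) $ i\<bar>) * sqrt (2 / pi)) \<partial>\<pi>)"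
    by (intro nn_integral_mono)
  \<comment> \<open>The bound on \<open>dn\<close> does not depend on the start and
    \<open>\<pi>\<close> has mass 1; this finiteness justifies the cancellation in
    \<open>ennreal\<close> below.\<close>
  then have fin: "(\<integral>\<^sup>+x. dn x \<partial>\<pi>) \<noteq> \<infinity>"
    by (auto simp: \<pi>.emeasure_space_1 top_unique)
  have same: "(\<integral>\<^sup>+x. up x \<partial>\<pi>) = (\<integral>\<^sup>+x. dn x \<partial>\<pi>)"
    unfolding up_def dn_def by (rule stationary_nn_integral_diff[OF \<pi> P inv]) auto
  have "(\<integral>\<^sup>+x. up x + ennreal r \<partial>\<pi>) = (\<integral>\<^sup>+x. dn x + (\<integral>\<^sup>+s. H s x \<partial>lborel) \<partial>\<pi>)"
    using balance by simp
  then have "(\<integral>\<^sup>+x. dn x \<partial>\<pi>) + ennreal r = (\<integral>\<^sup>+x. dn x \<partial>\<pi>) + (\<integral>\<^sup>+x. ennreal (h x) \<partial>\<pi>)"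
    using Hswap by (simp add: nn_integral_add same Hint \<pi>.emeasure_space_1)
  then have "(\<integral>\<^sup>+x. ennreal (h x) \<partial>\<pi>) = ennreal r"
    using fin by (metis ennreal_add_left_cancel infinity_ennreal_def)
  then show ?thesis
    using h0 r by (subst integral_eq_nn_integral) auto
qed


section \<open>Network structure and the matrices of the two classes\<close>

lemma tree_network_class_has_pool:
  assumes "tree_network E"
  obtains j where "E i j"
proof -
  \<comment> \<open>Whatever pool \<open>undefined\<close> denotes, its vertex differs from
    \<open>Inl i\<close>, so the connecting walk has a first edge.\<close>
  have "(adj E)\<^sup>*\<^sup>* (Inl i) (Inr undefined)" using assms by (simp add: tree_network_def)
  then obtain v where "adj E (Inl i) v" by (auto elim: converse_rtranclpE)
  then show thesis using that by (cases v) auto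
qed

text \<open>Otherwise all pools of class \<open>i\<close> would be leaves, attached to
  \<open>i\<close> only. Then \<open>i\<close> and its pools would be closed under adjacency, and
  \<open>d\<close> could not be reached.\<close>

lemma tree_network_dominant_pool:
  assumes tree: "tree_network E" and leaves: "\<And>j. \<not> leaf_pool E j \<longleftrightarrow> j = d"
  shows "E i d"
proof (rule ccontr)
  assume nd: "\<not> E i d"
  have "v = Inl i \<or> (\<exists>j. v = Inr j \<and> E i j)" if "(adj E)\<^sup>*\<^sup>* (Inl i) v" for v
    using that
  proof induction
    case (step v w)
    from step.IH show ?case
    proof (elim disjE exE conjE)
      assume "v = Inl i" then show ?thesis using step.hyps(2) by (cases w) auto
    next
      fix j assume j: "v = Inr j" "E i j"
      then have "leaf_pool E j" using nd leaves[of j] by blast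
      then obtain k where "{i. E i j} = {k}" unfolding leaf_pool_def by (rule card_1_singletonE)
      then have "{i. E i j} = {i}" using j(2) by (metis mem_Collect_eq singletonD)
      then show ?thesis using step.hyps(2) j by (cases w) auto
    qed
  qed simp
  from this[of "Inr d"] show False using tree nd by (simp add: tree_network_def)
qed

lemma matrix_inv_unique:
  fixes A :: "'a::semiring_1^'n^'m"
  assumes "A ** B = mat 1" "B ** A = mat 1"
  shows "matrix_inv A = B"
  unfolding matrix_inv_def
proof (rule some_equality)
  fix C assume "A ** C = mat 1 \<and> C ** A = mat 1"
  then show "C = B"
    using assms by (metis matrix_mul_assoc matrix_mul_rid matrix_mul_lid)
qed (simp add: assms)

lemma diag_vector_mult: "diag c *v x = (\<chi> i. c $ i * x $ i)"
  by (simp add: vec_eq_iff diag_def matrix_vector_mult_def if_distrib[of "\<lambda>a. a * _"] cong: if_cong)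

lemma matrix_inv_diag:
  fixes c :: "real^'n"
  assumes "\<And>i. c $ i \<noteq> 0"
  shows "matrix_inv (diag c) = diag (\<chi> i. 1 / c $ i)"
proof (rule matrix_inv_unique)
  show "diag c ** diag (\<chi> i. 1 / c $ i) = mat 1" "diag (\<chi> i. 1 / c $ i) ** diag c = mat 1"
    using assms by (simp_all add: matrix_eq matrix_vector_mul_assoc[symmetric] diag_vector_mult vec_eq_iff)
qed

text \<open>A diagonal matrix is symmetric, so its inverse moves to the other factor;
  \<open>(\<chi> i. 1 / c $ i)\<close> is the vector \<open>a\<close> with which the diffusion is
  tested.\<close>

lemma inner_matrix_inv_diag:
  assumes "\<And>i. c $ i \<noteq> 0"
  shows "1 \<bullet> (matrix_inv (diag c) *v x) = (\<chi> i. 1 / c $ i) \<bullet> x"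
  using assms by (simp add: matrix_inv_diag diag_vector_mult inner_vec_def)

text \<open>Testing with \<open>a\<close> cancels \<open>diag c\<close>. As the entries of
  \<open>fst v\<close> sum to 1, what remains of that term is the positive part of
  \<open>1 \<bullet> x\<close> minus \<open>1 \<bullet> x\<close>, that is, the negative part, and
  the choice of \<open>fst v\<close> drops out.\<close>

lemma inner_drift_diag:
  assumes c: "\<And>i. c $ i \<noteq> 0" and v: "fst v \<in> prob_simplex"
  shows "(\<chi> i. 1 / c $ i) \<bullet> drift l (diag c) B2 x v =
    (1 + 1 \<bullet> (matrix_inv (diag c) *v (B2 *v snd v))) * neg_part (1 \<bullet> x) - spare_capacity (diag c) l"
proof -
  have 1: "(\<chi> i. 1 / c $ i) \<bullet> (diag c *v y) = 1 \<bullet> y" for y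
    using c by (simp add: diag_vector_mult inner_vec_def)
  have "1 \<bullet> fst v = 1" using v by (simp add: prob_simplex_def inner_vec_def)
  then show ?thesis
    unfolding drift_def spare_capacity_def inner_matrix_inv_diag[OF c]
    by (simp add: 1 pos_part_def neg_part_def algebra_simps max_def)
qed

text \<open>The weight is the average over \<open>v\<close> of 1 plus the column sums of
  \<open>matrix_inv B1 ** B2\<close>. Column \<open>d\<close> vanishes; any other pool
  \<open>j\<close> is a leaf serving a single class \<open>k\<close>, and its term is the ratio
  \<open>mu $ k $ j / mu $ k $ d\<close>.\<close>

lemma idle_weight_nonneg_class_D:
  assumes tree: "tree_network E" and mu_pos: "\<And>i j. E i j \<Longrightarrow> 0 < mu $ i $ j"
    and D: "class_D E mu d B1 B2" and v: "v \<in> prob_simplex"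
  shows "0 \<le> 1 + 1 \<bullet> (matrix_inv B1 *v (B2 *v v))"
proof -
  have leaves: "\<And>j. \<not> leaf_pool E j \<longleftrightarrow> j = d" using D by (simp add: class_D_def)
  have d: "0 < mu $ i $ d" for i using mu_pos tree_network_dominant_pool[OF tree leaves] by blast
  have B1: "B1 = diag (\<chi> i. mu $ i $ d)"
    and B2: "B2 = (\<chi> i j. if E i j \<and> j \<noteq> d then mu $ i $ j - mu $ i $ d else 0)"
    using D by (auto simp: class_D_def)
  have nz: "(\<chi> i. mu $ i $ d) $ i \<noteq> 0" for i using d[of i] by simp
  have v0: "0 \<le> v $ j" and v1: "(\<Sum>j\<in>UNIV. v $ j) = 1" for j using v by (auto simp: prob_simplex_def)
  have col: "0 \<le> 1 + (\<Sum>i\<in>UNIV. B2 $ i $ j / mu $ i $ d)" for j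
  proof (cases "j = d")
    case False
    then have "leaf_pool E j" using leaves[of j] by blast
    then obtain k where k: "{i. E i j} = {k}" unfolding leaf_pool_def by (rule card_1_singletonE)
    then have E: "E i j \<longleftrightarrow> i = k" for i by blast
    have "(\<Sum>i\<in>UNIV. B2 $ i $ j / mu $ i $ d) = (\<Sum>i\<in>UNIV. if i = k then mu $ k $ j / mu $ k $ d - 1 else 0)"
      using False nz by (intro sum.cong) (auto simp: B2 E diff_divide_distrib)
    then show ?thesis using d[of k] mu_pos[of k j] E by simp
  qed (simp add: B2)
  have "1 \<bullet> (matrix_inv B1 *v (B2 *v v)) = (\<Sum>i\<in>UNIV. (\<Sum>j\<in>UNIV. v $ j * (B2 $ i $ j / mu $ i $ d)))"
    unfolding B1 inner_matrix_inv_diag[OF nz]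
    by (simp add: inner_vec_def matrix_vector_mult_def sum_divide_distrib mult.commute)
  also have "\<dots> = (\<Sum>j\<in>UNIV. v $ j * (\<Sum>i\<in>UNIV. B2 $ i $ j / mu $ i $ d))"
    by (subst sum.swap) (simp add: sum_distrib_left)
  \<comment> \<open>The leading 1 is absorbed into the average because the entries of
    \<open>v\<close> sum to 1.\<close>
  finally have "1 + 1 \<bullet> (matrix_inv B1 *v (B2 *v v)) = (\<Sum>j\<in>UNIV. v $ j * (1 + (\<Sum>i\<in>UNIV. B2 $ i $ j / mu $ i $ d)))"
    using v1 by (simp add: distrib_left sum.distrib)
  then show ?thesis using v0 col by (simp add: sum_nonneg)
qed

text \<open>What the two network classes share: a positive diagonal \<open>B1\<close> and a
  nonnegative weight, which in class (C) is 1 because \<open>B2\<close> is 0.\<close>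

lemma network_class_diag:
  assumes tree: "tree_network E" and mu_pos: "\<And>i j. E i j \<Longrightarrow> 0 < mu $ i $ j"
    and network: "(\<exists>d. class_D E mu d B1 B2) \<or> (\<exists>c. class_C E mu c B1 B2)"
  obtains c where "B1 = diag c" "\<And>i. 0 < c $ i"
    "\<And>v. v \<in> prob_simplex \<Longrightarrow> 0 \<le> 1 + 1 \<bullet> (matrix_inv B1 *v (B2 *v v))"
  using network
proof (elim disjE exE)
  fix d assume D: "class_D E mu d B1 B2"
  then have "\<And>j. \<not> leaf_pool E j \<longleftrightarrow> j = d" by (simp add: class_D_def)
  then have "0 < (\<chi> i. mu $ i $ d) $ i" for i
    using mu_pos tree_network_dominant_pool[OF tree] by simp
  then show thesis
    using that[of "\<chi> i. mu $ i $ d"] D idle_weight_nonneg_class_D[OF tree mu_pos D] by (auto simp: class_D_def)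
next
  fix c assume C: "class_C E mu c B1 B2"
  have "0 < c $ i" for i
    using tree_network_class_has_pool[OF tree, of i] mu_pos[of i] C unfolding class_C_def by metis
  then show thesis using that[of c] C by (auto simp: class_C_def)
qed

lemma borel_measurable_matrix_vector_mult:
  fixes A :: "real^'n^'m"
  assumes "f \<in> borel_measurable M"
  shows "(\<lambda>x. A *v f x) \<in> borel_measurable M"
  by (rule borel_measurable_continuous_on[OF _ assms]) (simp add: matrix_vector_mult_linear_continuous_on)

section \<open>Application to the controlled network diffusion\<close>

theorem theorem3p1:
  fixes E :: "'m::finite \<Rightarrow> 'j::finite \<Rightarrow> bool"
    and lam lam_hat :: "real^'m" and nu nu_hat :: "real^'j" and mu mu_hat \<xi>s :: "real^'j^'m"
    and B1 :: "real^'m^'m" and B2 :: "real^'j^'m" and l :: "real^'m"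
    and u :: "real^'m \<Rightarrow> (real^'m) \<times> (real^'j)"
    and M :: "real^'m \<Rightarrow> 'w measure" and F :: "real^'m \<Rightarrow> real \<Rightarrow> 'w measure"
    and W X :: "real^'m \<Rightarrow> real \<Rightarrow> 'w \<Rightarrow> real^'m"
    and \<pi> :: "(real^'m) measure"
  assumes tree: "tree_network E"
    and lam_pos: "\<And>i. 0 < lam $ i" and nu_pos: "\<And>j. 0 < nu $ j"
    and mu_pos: "\<And>i j. E i j \<Longrightarrow> 0 < mu $ i $ j"
    and mu_zero: "\<And>i j. \<not> E i j \<Longrightarrow> mu $ i $ j = 0"
    and crp: "complete_resource_pooling E lam mu nu \<xi>s"
    and network_class: "(\<exists>d. class_D E mu d B1 B2) \<or> (\<exists>c. class_C E mu c B1 B2)"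
    and l_eq: "l = ell E mu nu \<xi>s lam_hat mu_hat nu_hat"
    and spare_pos: "0 < spare_capacity B1 l"
    and control: "stationary_markov_control u"
    and diffusion: "\<And>x. sde_solution (\<lambda>y. drift l B1 B2 y (u y)) (diag (\<chi> i. sqrt (2 * lam $ i)))
                          x (M x) (F x) (W x) (X x)"
    and invariant: "invariant_prob_measure (\<lambda>t x. distr (M x) borel (X x t)) \<pi>"
  shows "spare_capacity B1 l =
    (\<integral>x. (1 + 1 \<bullet> (matrix_inv B1 *v (B2 *v snd (u x)))) * neg_part (1 \<bullet> x) \<partial>\<pi>)"
proof -
  define k where "k x = 1 + 1 \<bullet> (matrix_inv B1 *v (B2 *v snd (u x)))" for x
  obtain c where B1: "B1 = diag c" and c: "\<And>i. 0 < c $ i"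
    and k0: "\<And>v. v \<in> prob_simplex \<Longrightarrow> 0 \<le> 1 + 1 \<bullet> (matrix_inv B1 *v (B2 *v v))"
    using network_class_diag[OF tree mu_pos network_class] by blast
  have nz: "c $ i \<noteq> 0" for i using c[of i] by simp
  have u_simplex: "fst (u x) \<in> prob_simplex" "snd (u x) \<in> prob_simplex" for x
    using control by (auto simp: stationary_markov_control_def mem_Times_iff)
  have "u \<in> borel \<rightarrow>\<^sub>M borel \<Otimes>\<^sub>M borel"
    using control by (simp add: stationary_markov_control_def borel_prod)
  then have [measurable]: "(\<lambda>x. snd (u x)) \<in> borel_measurable borel" by measurable
  have "(\<lambda>x. matrix_inv B1 *v (B2 *v snd (u x))) \<in> borel_measurable borel"
    by (intro borel_measurable_matrix_vector_mult) simp
  then have [measurable]: "k \<in> borel_measurable borel" unfolding k_def by measurable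
  have "(\<integral>x. k x * neg_part (1 \<bullet> x) \<partial>\<pi>) = spare_capacity B1 l"
  \<comment> \<open>Here \<open>h\<close> is the integrand of the claim, \<open>r\<close> the spare
    capacity and \<open>a\<close> the vector of reciprocals of \<open>c\<close>.\<close>
  proof (rule integral_stationary_drift[OF diffusion invariant])
    show "(\<lambda>x. k x * neg_part (1 \<bullet> x)) \<in> borel_measurable borel"
      unfolding neg_part_def by measurable
    show "0 \<le> k x * neg_part (1 \<bullet> x)" for x
      using k0[OF u_simplex(2)] by (simp add: k_def neg_part_def)
    show "(\<chi> i. 1 / c $ i) \<bullet> drift l B1 B2 x (u x) = k x * neg_part (1 \<bullet> x) - spare_capacity B1 l" for x
      unfolding B1 k_def by (rule inner_drift_diag[OF nz u_simplex(1)])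
  qed (use spare_pos in simp)
  then show ?thesis by (simp add: k_def)
qed

end
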